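(* Let $V\subseteq\mathscr V(D)$ and consider the mixed-integer problem in the variables $z=(z_F)_{F\in\mathscr F_{\le n_x}}$, $s$, $x\in\mathbb R^{n_x}$, $y=(y_F)_{F\in\mathscr F_{\le n_x}}$ with $y_F\in\mathbb R^{n_y}$: $$\begin{aligned}\max_{z,s,x,y}\ & \sum_{F\in\mathscr F_{\le n_x}}z_F\\ \text{s.t. }& Ax+By_F\le b && \forall F\in\mathscr F_{\le n_x},\\ & A_Fx+B_Fy_F\ge b_F-M_F(1-z_F) && \forall F\in\mathscr F_{\le n_x},\\ & s+\sum_{F\in\mathscr F_{\le n_x}\setminus\ell(v)}z_F\ge1 && \forall v\in V,\\ & \sum_{F\in\mathscr F_{\le n_x}}z_F\le|\mathscr F_{\le n_x}|(1-s),\\ & z_F\in\{0,1\}\ \ \forall F\in\mathscr F_{\le n_x},\qquad s\in\{0,1\}.\end{aligned}$$ This problem is feasible provided that $D\ne\emptyset$. Moreover, for an optimal solution $(z^*,s^*,x^*,y^* )$, one and only one of the following holds: - $s^*=0$ and $x^*\in\mathscr V(D)\setminus V$; - $s^*=1$ and $\mathscr V(D)=V$.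
   Context: Let $A\in\mathbb R^{m\times n_x}$, $B\in\mathbb R^{m\times n_y}$, $b\in\mathbb R^m$, and $D=\{(x,y)\in\mathbb R^{n_x}\times\mathbb R^{n_y}:Ax+By\le b\}$, assumed compact and full-dimensional. Let $\pi(x,y)=x$ and $X=\pi(D)$. A face of a polytope $P$ is the set of maximizers over $P$ of a linear function ($P$ itself is a face); $\mathscr F(D)$ is the set of all faces of $D$, and $\mathscr F_{\le n_x}$ is the set of faces of $D$ of affine dimension at most $n_x$. For $x\in X$ the chamber of $x$ is $\sigma(x)=\bigcap\{\pi(F):F\in\mathscr F(D),\ x\in\pi(F)\}$; the chamber complex is $\mathscr C(D)=\{\sigma(x):x\in X\}$; $\mathscr V(D)=\{v\in X:\{v\}\in\mathscr C(D)\}$. The label of a chamber $C$ is $\ell(C)=\{F\in\mathscr F_{\le n_x}:C\subseteq\pi(F)\}$, and $\ell(x)=\ell(\sigma(x))$ for $x\in X$. For each $F\in\mathscr F_{\le n_x}$, $A_F,B_F,b_F$ are submatrices of $A,B,b$ given by a common set of row indices such that $F=\{(x,y)\in D:A_Fx+B_Fy=b_F\}$. $M\in\mathbb R^m$ is a fixed vector of positive values such that $A_ix+B_iy-b_i\ge-M_i$ for all $(x,y)\in D$ and all $i$ ($A_i,B_i$ being the $i$th rows), and $M_F$ is the subvector of $M$ with the same indices as $b_F$. *)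

theory Defs
  imports "HOL-Analysis.Analysis"
begin

definition feasible_polyhedron ::
  "real ^ 'nx ^ 'm \<Rightarrow> real ^ 'ny ^ 'm \<Rightarrow> real ^ 'm \<Rightarrow> ((real ^ 'nx) \<times> (real ^ 'ny)) set"
  where "feasible_polyhedron A B b = {(x, y). \<forall>i. (A *v x + B *v y) $ i \<le> b $ i}"

text \<open>
  Unlike with \<^const>\<open>face_of\<close> and \<^const>\<open>exposed_face_of\<close>, the empty set is not a face of a
  nonempty polytope here: a linear function attains its maximum on a compact set.
\<close>

definition polytope_faces :: "'a::real_vector set \<Rightarrow> 'a set set"
  where "polytope_faces P =
    {F. \<exists>f :: 'a \<Rightarrow> real. linear f \<and> F = {p \<in> P. \<forall>q \<in> P. f q \<le> f p}}"

definition low_dim_faces ::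
  "((real ^ 'nx) \<times> (real ^ 'ny)) set \<Rightarrow> ((real ^ 'nx) \<times> (real ^ 'ny)) set set"
  where "low_dim_faces D = {F \<in> polytope_faces D. aff_dim F \<le> int CARD('nx)}"

text \<open>The projection onto the first factor is \<^const>\<open>fst\<close>.\<close>

definition chamber ::
  "((real ^ 'nx) \<times> (real ^ 'ny)) set \<Rightarrow> real ^ 'nx \<Rightarrow> (real ^ 'nx) set"
  where "chamber D x = \<Inter> {fst ` F | F. F \<in> polytope_faces D \<and> x \<in> fst ` F}"

definition chamber_complex ::
  "((real ^ 'nx) \<times> (real ^ 'ny)) set \<Rightarrow> (real ^ 'nx) set set"
  where "chamber_complex D = {chamber D x | x. x \<in> fst ` D}"

definition chamber_vertices ::
  "((real ^ 'nx) \<times> (real ^ 'ny)) set \<Rightarrow> (real ^ 'nx) set"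
  where "chamber_vertices D = {v \<in> fst ` D. {v} \<in> chamber_complex D}"

definition chamber_label ::
  "((real ^ 'nx) \<times> (real ^ 'ny)) set \<Rightarrow> (real ^ 'nx) set \<Rightarrow> ((real ^ 'nx) \<times> (real ^ 'ny)) set set"
  where "chamber_label D C = {F \<in> low_dim_faces D. C \<subseteq> fst ` F}"

definition point_label ::
  "((real ^ 'nx) \<times> (real ^ 'ny)) set \<Rightarrow> real ^ 'nx \<Rightarrow> ((real ^ 'nx) \<times> (real ^ 'ny)) set set"
  where "point_label D x = chamber_label D (chamber D x)"

text \<open>
  \<^term>\<open>R F\<close> is the set of row indices that selects the submatrices (and subvectors)
  \<open>A\<^sub>F\<close>, \<open>B\<^sub>F\<close>, \<open>b\<^sub>F\<close>, \<open>M\<^sub>F\<close>.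
\<close>

definition describes_faces ::
  "real ^ 'nx ^ 'm \<Rightarrow> real ^ 'ny ^ 'm \<Rightarrow> real ^ 'm
    \<Rightarrow> (((real ^ 'nx) \<times> (real ^ 'ny)) set \<Rightarrow> 'm set) \<Rightarrow> bool"
  where "describes_faces A B b R \<longleftrightarrow>
    (\<forall>F \<in> low_dim_faces (feasible_polyhedron A B b).
      F = {(x, y) \<in> feasible_polyhedron A B b. \<forall>i \<in> R F. (A *v x + B *v y) $ i = b $ i})"

text \<open>
  The families \<open>z\<close> and \<open>y\<close> are total functions on sets; only their values at members of
  \<^term>\<open>low_dim_faces D\<close> matter. For a polytope \<open>D\<close> this index set is finite, so the sums and the
  cardinality below are never the default value for infinite sets.
\<close>

definition mip_objective ::
  "((real ^ 'nx) \<times> (real ^ 'ny)) set \<Rightarrow> (((real ^ 'nx) \<times> (real ^ 'ny)) set \<Rightarrow> real) \<Rightarrow> real"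
  where "mip_objective D z = (\<Sum>F \<in> low_dim_faces D. z F)"

definition mip_feasible ::
  "real ^ 'nx ^ 'm \<Rightarrow> real ^ 'ny ^ 'm \<Rightarrow> real ^ 'm \<Rightarrow> real ^ 'm
    \<Rightarrow> (((real ^ 'nx) \<times> (real ^ 'ny)) set \<Rightarrow> 'm set) \<Rightarrow> (real ^ 'nx) set
    \<Rightarrow> (((real ^ 'nx) \<times> (real ^ 'ny)) set \<Rightarrow> real) \<Rightarrow> real \<Rightarrow> real ^ 'nx
    \<Rightarrow> (((real ^ 'nx) \<times> (real ^ 'ny)) set \<Rightarrow> real ^ 'ny) \<Rightarrow> bool"
  where "mip_feasible A B b M R V z s x y \<longleftrightarrow>
    (let D = feasible_polyhedron A B b; \<F> = low_dim_faces D in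
      (\<forall>F \<in> \<F>. \<forall>i. (A *v x + B *v y F) $ i \<le> b $ i) \<and>
      (\<forall>F \<in> \<F>. \<forall>i \<in> R F. (A *v x + B *v y F) $ i \<ge> b $ i - M $ i * (1 - z F)) \<and>
      (\<forall>v \<in> V. s + (\<Sum>F \<in> \<F> - point_label D v. z F) \<ge> 1) \<and>
      (\<Sum>F \<in> \<F>. z F) \<le> real (card \<F>) * (1 - s) \<and>
      (\<forall>F \<in> \<F>. z F \<in> {0, 1}) \<and> s \<in> {0, 1})"

definition mip_optimal ::
  "real ^ 'nx ^ 'm \<Rightarrow> real ^ 'ny ^ 'm \<Rightarrow> real ^ 'm \<Rightarrow> real ^ 'm
    \<Rightarrow> (((real ^ 'nx) \<times> (real ^ 'ny)) set \<Rightarrow> 'm set) \<Rightarrow> (real ^ 'nx) set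
    \<Rightarrow> (((real ^ 'nx) \<times> (real ^ 'ny)) set \<Rightarrow> real) \<Rightarrow> real \<Rightarrow> real ^ 'nx
    \<Rightarrow> (((real ^ 'nx) \<times> (real ^ 'ny)) set \<Rightarrow> real ^ 'ny) \<Rightarrow> bool"
  where "mip_optimal A B b M R V z s x y \<longleftrightarrow>
    mip_feasible A B b M R V z s x y \<and>
    (\<forall>z' s' x' y'. mip_feasible A B b M R V z' s' x' y' \<longrightarrow>
      mip_objective (feasible_polyhedron A B b) z' \<le> mip_objective (feasible_polyhedron A B b) z)"

end

theory Submission
  imports Defs
begin

text \<open>
  Two facts about the chamber complex carry the proof. Write \<open>\<ell>(x)\<close> for the label
  of \<open>x\<close>, which is the set of faces of dimension at most \<open>n\<^sub>x\<close> whose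
  projection contains \<open>x\<close> (\<open>point_label_eq\<close>).

  First, the faces of dimension at most \<open>n\<^sub>x\<close> already determine the chambers:
  \<open>\<sigma>(x)\<close> is the intersection of the projections of the faces in
  \<open>\<ell>(x)\<close> (\<open>chamber_eq_Inter_label\<close>). Indeed, among the faces of
  \<open>F\<close> that meet the fibre over \<open>x\<close>, one of least dimension has dimension
  at most \<open>n\<^sub>x\<close>, since otherwise it could be left through its relative boundary
  along a direction inside the fibre. Consequently, if \<open>v\<close> is a chamber vertex,
  \<open>\<ell>(v) \<subseteq> \<ell>(w)\<close> forces \<open>w = v\<close>
  (\<open>chamber_vertex_label_maximal\<close>).

  Second, if \<open>\<sigma>(x)\<close> is not the singleton \<open>{x}\<close>, then some \<open>w
  \<in> \<sigma>(x)\<close> has a label strictly larger than that of \<open>x\<close>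
  (\<open>label_grows_in_nontrivial_chamber\<close>). Take \<open>w\<close> to be a point of
  \<open>\<sigma>(x)\<close> at maximal distance from \<open>x\<close>. If the labels agreed, then
  \<open>x\<close> would lie in every face of the polytope \<open>\<pi>(F)\<close>, \<open>F \<in>
  \<ell>(x)\<close>, that has \<open>w\<close> in its relative interior, because the preimage of
  that face in \<open>F\<close> belongs to \<open>\<ell>(w)\<close>. The segment from
  \<open>x\<close> to \<open>w\<close> could then be prolonged beyond \<open>w\<close> inside
  \<open>\<sigma>(x)\<close>.

  As for the optimization problem: in a feasible solution \<open>z\<^sub>F = 1\<close> implies
  \<open>x \<in> \<pi>(F)\<close>, so the support of \<open>z\<close> is contained in
  \<open>\<ell>(x)\<close>, and for \<open>s = 0\<close> the constraint of \<open>v \<in> V\<close>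
  says that the support is not contained in \<open>\<ell>(v)\<close>. Conversely the indicator of
  \<open>\<ell>(x)\<close> is feasible with \<open>s = 0\<close> as soon as \<open>\<ell>(x)\<close>
  is contained in no \<open>\<ell>(v)\<close>. If \<open>s = 0\<close> in an optimal solution, then
  \<open>x\<close> is a chamber vertex, since otherwise the indicator of the larger label of the
  second fact would have a larger value, and it is not in \<open>V\<close> by the constraint of
  \<open>v = x\<close>. If \<open>s = 1\<close>, the objective vanishes, whereas any chamber vertex
  outside \<open>V\<close> would by the first fact yield a feasible solution of positive value.
\<close>

section \<open>Faces of polytopes\<close>

text \<open>
  On a nonempty polytope the sets of maximizers of linear functions are exactly the nonempty faces
  in the sense of \<^const>\<open>face_of\<close>, because every face of a polyhedron is exposed.
\<close>

lemma polytope_faces_eq: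
  fixes P :: "'a::euclidean_space set"
  assumes P: "polytope P" and ne: "P \<noteq> {}"
  shows "polytope_faces P = {F. F face_of P \<and> F \<noteq> {}}"
proof (intro set_eqI iffI)
  fix F assume "F \<in> polytope_faces P"
  then obtain f :: "'a \<Rightarrow> real" where f: "linear f" and F: "F = {p \<in> P. \<forall>q \<in> P. f q \<le> f p}"
    by (auto simp: polytope_faces_def)
  obtain p where p: "p \<in> P" "\<forall>q\<in>P. f q \<le> f p"
    using continuous_attains_sup[of P f] polytope_imp_compact[OF P] ne
      linear_continuous_on[of f P] f linear_conv_bounded_linear[of f] by auto
  \<comment> \<open>the vector that represents the functional \<open>f\<close>\<close>
  define a where "a = adjoint f 1"
  have fa: "f q = a \<bullet> q" for q
    using adjoint_works[OF f, of q 1] by (simp add: a_def inner_commute)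
  have Feq: "F = P \<inter> {q. a \<bullet> q = f p}"
  proof (intro set_eqI iffI)
    fix r assume "r \<in> F"
    then show "r \<in> P \<inter> {q. a \<bullet> q = f p}" using p by (simp add: F antisym flip: fa)
  next
    fix r assume "r \<in> P \<inter> {q. a \<bullet> q = f p}"
    then show "r \<in> F" using p by (simp add: F flip: fa)
  qed
  have "F face_of P"
    unfolding Feq
    by (rule face_of_Int_supporting_hyperplane_le)
      (use p polytope_imp_convex[OF P] in \<open>auto simp: fa\<close>)
  moreover have "p \<in> F" using p by (simp add: F)
  ultimately show "F \<in> {F. F face_of P \<and> F \<noteq> {}}" by auto
next
  fix F assume "F \<in> {F. F face_of P \<and> F \<noteq> {}}"
  then have "F exposed_face_of P" and Fne: "F \<noteq> {}"
    using exposed_face_of_polyhedron[OF polytope_imp_polyhedron[OF P]] by auto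
  then obtain a b where ab: "P \<subseteq> {x. a \<bullet> x \<le> b}" "F = P \<inter> {x. a \<bullet> x = b}"
    by (auto simp: exposed_face_of_def)
  obtain p where p: "p \<in> P" "a \<bullet> p = b" using Fne ab by auto
  have le: "a \<bullet> q \<le> b" if "q \<in> P" for q using ab(1) that by blast
  have "F = {p \<in> P. \<forall>q \<in> P. a \<bullet> q \<le> a \<bullet> p}"
  proof (intro set_eqI iffI)
    fix r assume "r \<in> F"
    then show "r \<in> {p \<in> P. \<forall>q \<in> P. a \<bullet> q \<le> a \<bullet> p}" using le by (simp add: ab(2))
  next
    fix r assume "r \<in> {p \<in> P. \<forall>q \<in> P. a \<bullet> q \<le> a \<bullet> p}"
    then have "r \<in> P" "b \<le> a \<bullet> r" using p by auto
    then show "r \<in> F" using le[of r] by (simp add: ab(2))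
  qed
  moreover have "linear (\<lambda>x. a \<bullet> x)"
    by (rule bounded_linear.linear[OF bounded_linear_inner_right])
  ultimately show "F \<in> polytope_faces P"
    unfolding polytope_faces_def by blast
qed

lemma exists_face_rel_interior:
  fixes P :: "'a::euclidean_space set"
  assumes P: "polytope P" and w: "w \<in> P"
  shows "\<exists>H. H face_of P \<and> w \<in> rel_interior H"
proof -
  \<comment> \<open>A face of least dimension through \<open>w\<close> will do: its relative boundary consists of proper faces.\<close>
  obtain H where H: "H face_of P" "w \<in> H"
    and least: "\<And>G. G face_of P \<Longrightarrow> w \<in> G \<Longrightarrow> nat (aff_dim H) \<le> nat (aff_dim G)"
    using ex_has_least_nat[of "\<lambda>H. H face_of P \<and> w \<in> H" P "\<lambda>H. nat (aff_dim H)"]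
      face_of_refl[OF polytope_imp_convex[OF P]] w by blast
  have polyH: "polytope H" using face_of_polytope_polytope[OF P H(1)] .
  have "w \<in> rel_interior H"
  proof (rule ccontr)
    assume "w \<notin> rel_interior H"
    then have "w \<in> rel_frontier H"
      using H(2) closure_subset[of H] by (auto simp: rel_frontier_def)
    then obtain G where G: "G face_of H" "G \<noteq> H" "w \<in> G"
      using rel_frontier_of_polyhedron_alt[OF polytope_imp_polyhedron[OF polyH]] by auto
    have "aff_dim G < aff_dim H"
      by (rule face_of_aff_dim_lt[OF polytope_imp_convex[OF polyH] G(1,2)])
    moreover have "0 \<le> aff_dim G" using G(3) aff_dim_negative_iff[of G] by (metis empty_iff not_less)
    ultimately show False
      using least[of G] face_of_trans[OF G(1) H(1)] G(3) by auto
  qed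
  then show ?thesis using H by blast
qed

lemma face_of_vimage_linear:
  fixes f :: "'a::real_vector \<Rightarrow> 'b::real_vector"
  assumes f: "linear f" and P: "convex P" and H: "H face_of f ` P"
  shows "P \<inter> f -` H face_of P"
  unfolding face_of_def
proof (intro conjI ballI impI)
  show "convex (P \<inter> f -` H)"
    using P H convex_linear_vimage[OF f] by (simp add: convex_Int face_of_imp_convex)
next
  fix a b x assume a: "a \<in> P" and b: "b \<in> P" and x: "x \<in> P \<inter> f -` H" and seg: "x \<in> open_segment a b"
  obtain u where u: "0 < u" "u < 1" "x = (1 - u) *\<^sub>R a + u *\<^sub>R b"
    using seg by (auto simp: in_segment)
  have fx: "f x = (1 - u) *\<^sub>R f a + u *\<^sub>R f b"
    using u(3) by (simp add: linear_add[OF f] linear_cmul[OF f])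
  have "f a \<in> H \<and> f b \<in> H"
  proof (cases "f a = f b")
    case True
    then have "f x = f a" using fx by (simp flip: scaleR_add_left)
    then show ?thesis using x True by simp
  next
    case False
    then have "f x \<in> open_segment (f a) (f b)" using u fx by (auto simp: in_segment)
    then show ?thesis using H a b x unfolding face_of_def by blast
  qed
  then show "a \<in> P \<inter> f -` H" "b \<in> P \<inter> f -` H" using a b by auto
qed auto

text \<open>
  The affine hull of a set of larger dimension than the base of the projection contains a line
  inside each fibre that the set meets. This is the reason for the bound \<open>n\<^sub>x\<close> on the dimension.
\<close>

lemma affine_fibre_direction:
  fixes S :: "('a::euclidean_space \<times> 'b::euclidean_space) set"
  assumes dim: "aff_dim S > int DIM('a)" and p: "p \<in> S"
  shows "\<exists>l. l \<noteq> 0 \<and> fst l = 0 \<and> p + l \<in> affine hull S"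
proof -
  define L where "L = (\<lambda>x. x - p) ` (affine hull S)"
  have pa: "p \<in> affine hull S" using p by (simp add: hull_inc)
  have L: "subspace L"
    unfolding L_def by (rule affine_diffs_subspace_subtract[OF affine_affine_hull pa])
  have dimL: "int (dim L) = aff_dim S"
    unfolding L_def using aff_dim_dim_affine_diffs[OF affine_affine_hull pa] by simp
  have "\<not> inj_on fst L"
  proof
    assume "inj_on fst L"
    then have "dim (fst ` L) = dim L"
      using dim_image_eq[OF linear_fst, of L] span_eq_iff[of L] L by metis
    moreover have "dim (fst ` L) \<le> DIM('a)" by (rule dim_subset_UNIV)
    ultimately show False using dimL dim by simp
  qed
  then obtain u v where uv: "u \<in> L" "v \<in> L" "fst u = fst v" "u \<noteq> v"
    by (auto simp: inj_on_def)
  have "u - v \<in> L" using L uv by (simp add: subspace_diff)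
  then have "p + (u - v) \<in> affine hull S" by (auto simp: L_def)
  moreover have "fst (u - v) = 0" "u - v \<noteq> 0" using uv by auto
  ultimately show ?thesis by blast
qed

text \<open>
  A face of least dimension among those meeting the fibre over \<open>x\<close> meets it only in its relative
  interior, so its affine hull contains no direction of the fibre.
\<close>

lemma exists_low_dim_face_over_point:
  fixes F :: "('a::euclidean_space \<times> 'b::euclidean_space) set"
  assumes F: "polytope F" and x: "x \<in> fst ` F"
  shows "\<exists>G. G face_of F \<and> x \<in> fst ` G \<and> aff_dim G \<le> int DIM('a)"
proof -
  obtain G where G: "G face_of F" "x \<in> fst ` G"
    and least: "\<And>K. K face_of F \<Longrightarrow> x \<in> fst ` K \<Longrightarrow> nat (aff_dim G) \<le> nat (aff_dim K)"
    using ex_has_least_nat[of "\<lambda>H. H face_of F \<and> x \<in> fst ` H" F "\<lambda>H. nat (aff_dim H)"]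
      face_of_refl[OF polytope_imp_convex[OF F]] x by blast
  have polyG: "polytope G" using face_of_polytope_polytope[OF F G(1)] .
  have inner: "p \<notin> rel_frontier G" if "fst p = x" for p
  proof
    assume "p \<in> rel_frontier G"
    then obtain K where K: "K face_of G" "K \<noteq> G" "p \<in> K"
      using rel_frontier_of_polyhedron_alt[OF polytope_imp_polyhedron[OF polyG]] by auto
    have "aff_dim K < aff_dim G"
      by (rule face_of_aff_dim_lt[OF polytope_imp_convex[OF polyG] K(1,2)])
    moreover have "0 \<le> aff_dim K" using K(3) aff_dim_negative_iff[of K] by (metis empty_iff not_less)
    moreover have "x \<in> fst ` K" using K(3) that by force
    ultimately show False
      using least[of K] face_of_trans[OF K(1) G(1)] by auto
  qed
  have "aff_dim G \<le> int DIM('a)"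
  proof (rule ccontr)
    assume "\<not> aff_dim G \<le> int DIM('a)"
    moreover obtain p where p: "p \<in> G" "fst p = x" using G by auto
    ultimately obtain l where l: "l \<noteq> 0" "fst l = 0" "p + l \<in> affine hull G"
      using affine_fibre_direction[of G p] by auto
    have "p \<in> rel_interior G"
      using inner[OF p(2)] p(1) closure_subset[of G] by (auto simp: rel_frontier_def)
    then obtain d where "p + d *\<^sub>R l \<in> rel_frontier G"
      using ray_to_rel_frontier[OF polytope_imp_bounded[OF polyG] _ l(3,1)] by blast
    then show False using inner[of "p + d *\<^sub>R l"] p l by simp
  qed
  then show ?thesis using G by blast
qed

section \<open>Chambers and their labels\<close>

lemma mem_chamber_self: "x \<in> chamber D x"
  by (auto simp: chamber_def)

lemma mem_chamberD: "w \<in> chamber D x \<Longrightarrow> F \<in> polytope_faces D \<Longrightarrow> x \<in> fst ` F \<Longrightarrow> w \<in> fst ` F"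
  unfolding chamber_def by blast

lemma point_label_eq: "point_label D x = {F \<in> low_dim_faces D. x \<in> fst ` F}"
proof -
  have "chamber D x \<subseteq> fst ` F \<longleftrightarrow> x \<in> fst ` F" if "F \<in> low_dim_faces D" for F
  proof
    assume "chamber D x \<subseteq> fst ` F"
    then show "x \<in> fst ` F" using mem_chamber_self by blast
  next
    assume x: "x \<in> fst ` F"
    have "F \<in> polytope_faces D" using that by (simp add: low_dim_faces_def)
    then show "chamber D x \<subseteq> fst ` F" using mem_chamberD[OF _ _ x] by blast
  qed
  then show ?thesis unfolding point_label_def chamber_label_def by blast
qed

lemma point_label_mono:
  assumes "w \<in> chamber D x"
  shows "point_label D x \<subseteq> point_label D w"
  using mem_chamberD[OF assms] unfolding point_label_eq low_dim_faces_def by blast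

lemma chamber_vertices_eq: "chamber_vertices D = {v \<in> fst ` D. chamber D v = {v}}"
proof (intro set_eqI iffI)
  fix v assume "v \<in> chamber_vertices D"
  then obtain x where v: "v \<in> fst ` D" and x: "{v} = chamber D x"
    unfolding chamber_vertices_def chamber_complex_def by blast
  then have "x = v" using mem_chamber_self[of x D] by blast
  then show "v \<in> {v \<in> fst ` D. chamber D v = {v}}" using v x by simp
next
  fix v assume "v \<in> {v \<in> fst ` D. chamber D v = {v}}"
  then have "v \<in> fst ` D" "{v} = chamber D v" by simp_all
  then show "v \<in> chamber_vertices D"
    unfolding chamber_vertices_def chamber_complex_def by blast
qed

lemma low_dim_faces_eq:
  fixes D :: "((real ^ 'nx) \<times> (real ^ 'ny)) set"
  assumes "polytope D" "D \<noteq> {}"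
  shows "low_dim_faces D = {F. F face_of D \<and> F \<noteq> {} \<and> aff_dim F \<le> int CARD('nx)}"
  by (auto simp: low_dim_faces_def polytope_faces_eq[OF assms])

lemma low_dim_faces_face_closed:
  fixes D :: "((real ^ 'nx) \<times> (real ^ 'ny)) set"
  assumes D: "polytope D" "D \<noteq> {}" and F: "F \<in> low_dim_faces D" and G: "G face_of F" "G \<noteq> {}"
  shows "G \<in> low_dim_faces D"
  using F G face_of_trans[OF G(1)] aff_dim_subset[OF face_of_imp_subset[OF G(1)]]
  by (auto simp: low_dim_faces_eq[OF D])

lemma finite_low_dim_faces:
  fixes D :: "((real ^ 'nx) \<times> (real ^ 'ny)) set"
  assumes "polytope D" "D \<noteq> {}"
  shows "finite (low_dim_faces D)"
  by (rule finite_subset[OF _ finite_polytope_faces[OF assms(1)]])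
    (auto simp: low_dim_faces_eq[OF assms])

lemma low_dim_subface:
  fixes D :: "((real ^ 'nx) \<times> (real ^ 'ny)) set"
  assumes D: "polytope D" "D \<noteq> {}" and F: "F face_of D" and x: "x \<in> fst ` F"
  shows "\<exists>G \<in> low_dim_faces D. G \<subseteq> F \<and> x \<in> fst ` G"
proof -
  obtain G where G: "G face_of F" "x \<in> fst ` G" "aff_dim G \<le> int DIM(real ^ 'nx)"
    using exists_low_dim_face_over_point[OF face_of_polytope_polytope[OF D(1) F] x] by blast
  then have "G \<in> low_dim_faces D"
    using face_of_trans[OF G(1) F] by (auto simp: low_dim_faces_eq[OF D])
  then show ?thesis using G face_of_imp_subset by blast
qed

lemma point_label_nonempty:
  assumes "polytope D" "D \<noteq> {}" "x \<in> fst ` D"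
  shows "point_label D x \<noteq> {}"
  using low_dim_subface[OF assms(1,2) face_of_refl[OF polytope_imp_convex[OF assms(1)]] assms(3)]
  by (auto simp: point_label_eq)

lemma chamber_eq_Inter_label:
  assumes D: "polytope D" "D \<noteq> {}"
  shows "chamber D x = (\<Inter>F \<in> point_label D x. fst ` F)"
proof (intro subset_antisym subsetI)
  fix w assume "w \<in> chamber D x"
  then show "w \<in> (\<Inter>F \<in> point_label D x. fst ` F)"
    by (auto simp: point_label_eq low_dim_faces_def dest: mem_chamberD)
next
  fix w assume w: "w \<in> (\<Inter>F \<in> point_label D x. fst ` F)"
  have "w \<in> fst ` F" if F: "F \<in> polytope_faces D" "x \<in> fst ` F" for F
  proof -
    have "F face_of D" using F by (simp add: polytope_faces_eq[OF D])
    then obtain G where "G \<in> low_dim_faces D" "G \<subseteq> F" "x \<in> fst ` G"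
      using low_dim_subface[OF D _ F(2)] by blast
    then have "w \<in> fst ` G" using w unfolding point_label_eq by blast
    then show ?thesis using \<open>G \<subseteq> F\<close> by blast
  qed
  then show "w \<in> chamber D x" by (auto simp: chamber_def)
qed

lemma chamber_vertex_label_maximal:
  assumes D: "polytope D" "D \<noteq> {}" and v: "v \<in> chamber_vertices D"
    and sub: "point_label D v \<subseteq> point_label D w"
  shows "w = v"
proof -
  have "w \<in> chamber D v"
    using sub unfolding chamber_eq_Inter_label[OF D] by (auto simp: point_label_eq)
  then show ?thesis using v by (simp add: chamber_vertices_eq)
qed

lemma compact_chamber:
  fixes D :: "((real ^ 'nx) \<times> (real ^ 'ny)) set"
  assumes D: "polytope D" "D \<noteq> {}" and x: "x \<in> fst ` D"
  shows "compact (chamber D x)"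
proof -
  have "compact (fst ` F)" if "F \<in> point_label D x" for F
    using that face_of_polytope_polytope[OF D(1)] polytope_linear_image[OF linear_fst, of F]
    by (auto simp: point_label_eq low_dim_faces_eq[OF D] intro: polytope_imp_compact)
  then show ?thesis
    unfolding chamber_eq_Inter_label[OF D] using point_label_nonempty[OF D x]
    by (intro compact_Inter) auto
qed

text \<open>
  If the label of a point \<open>w\<close> of \<open>\<sigma>(x)\<close> is no larger than that of \<open>x\<close>, the segment from \<open>x\<close> to \<open>w\<close>
  can be prolonged inside the chamber: \<open>w\<close> is in the relative interior of a convex subset that contains \<open>x\<close>.
\<close>

lemma chamber_prolong:
  fixes D :: "((real ^ 'nx) \<times> (real ^ 'ny)) set"
  assumes D: "polytope D" "D \<noteq> {}"
    and w: "w \<in> chamber D x" and sub: "point_label D w \<subseteq> point_label D x"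
  shows "\<exists>e > 1. (1 - e) *\<^sub>R x + e *\<^sub>R w \<in> chamber D x"
proof -
  have "\<exists>H. H \<subseteq> fst ` F \<and> convex H \<and> w \<in> rel_interior H \<and> x \<in> H" if F: "F \<in> point_label D x" for F
  proof -
    have Flow: "F \<in> low_dim_faces D" using F by (simp add: point_label_eq)
    have polyF: "polytope F"
      using Flow face_of_polytope_polytope[OF D(1)] by (auto simp: low_dim_faces_eq[OF D])
    have wF: "w \<in> fst ` F"
      using F w unfolding chamber_eq_Inter_label[OF D] by blast
    then obtain H where H: "H face_of fst ` F" "w \<in> rel_interior H"
      using exists_face_rel_interior[OF polytope_linear_image[OF linear_fst polyF]] by blast
    \<comment> \<open>The preimage of \<open>H\<close> is a face below \<open>F\<close>, hence of low dimension, and it belongs to \<open>\<ell>(w)\<close>.\<close>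
    define G where "G = F \<inter> fst -` H"
    have wH: "w \<in> H" using H(2) rel_interior_subset by blast
    then have wG: "w \<in> fst ` G" using wF by (auto simp: G_def)
    have "G face_of F"
      unfolding G_def by (rule face_of_vimage_linear[OF linear_fst polytope_imp_convex[OF polyF] H(1)])
    then have "G \<in> point_label D w"
      using low_dim_faces_face_closed[OF D Flow] wG by (auto simp: point_label_eq)
    then have "x \<in> fst ` G" using sub by (auto simp: point_label_eq)
    then show ?thesis
      using H face_of_imp_subset[OF H(1)] face_of_imp_convex[OF H(1)] by (auto simp: G_def)
  qed
  then obtain h where h: "\<And>F. F \<in> point_label D x \<Longrightarrow>
      h F \<subseteq> fst ` F \<and> convex (h F) \<and> w \<in> rel_interior (h F) \<and> x \<in> h F"
    by metis
  define K where "K = \<Inter> (h ` point_label D x)"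
  have "rel_interior K = \<Inter> (rel_interior ` h ` point_label D x)"
    unfolding K_def
  proof (rule convex_rel_interior_finite_Inter)
    show "finite (h ` point_label D x)"
      using finite_low_dim_faces[OF D] by (simp add: point_label_eq)
  qed (use h in auto)
  then have "w \<in> rel_interior K" using h by auto
  moreover have "x \<in> K" using h by (auto simp: K_def)
  moreover have "convex K" unfolding K_def by (rule convex_Inter) (use h in auto)
  ultimately obtain e where "e > 1" "(1 - e) *\<^sub>R x + e *\<^sub>R w \<in> K"
    using convex_rel_interior_iff[of K w] by auto
  moreover have "K \<subseteq> chamber D x"
    unfolding chamber_eq_Inter_label[OF D] K_def using h by blast
  ultimately show ?thesis by blast
qed

text \<open>
  For the optimality argument it suffices that the label can be enlarged; the point \<open>w\<close> need not be a
  chamber vertex itself.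
\<close>

lemma label_grows_in_nontrivial_chamber:
  fixes D :: "((real ^ 'nx) \<times> (real ^ 'ny)) set"
  assumes D: "polytope D" "D \<noteq> {}" and x: "x \<in> fst ` D" and nontriv: "chamber D x \<noteq> {x}"
  shows "\<exists>w \<in> chamber D x. point_label D x \<subset> point_label D w"
proof -
  obtain w where w: "w \<in> chamber D x" and far: "\<And>y. y \<in> chamber D x \<Longrightarrow> dist x y \<le> dist x w"
    using distance_attains_sup[OF compact_chamber[OF D x], of x] mem_chamber_self[of x D] by blast
  obtain y where "y \<in> chamber D x" "y \<noteq> x" using nontriv mem_chamber_self[of x D] by blast
  then have "dist x w > 0" using far[of y] zero_less_dist_iff[of x y] by fastforce
  have "\<not> point_label D w \<subseteq> point_label D x"
  proof
    assume "point_label D w \<subseteq> point_label D x"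
    then obtain e where e: "e > 1" "(1 - e) *\<^sub>R x + e *\<^sub>R w \<in> chamber D x"
      using chamber_prolong[OF D w] by blast
    have "(1 - e) *\<^sub>R x + e *\<^sub>R w = x + e *\<^sub>R (w - x)" by (simp add: algebra_simps)
    then have "dist x ((1 - e) *\<^sub>R x + e *\<^sub>R w) = e * dist x w"
      using e(1) by (simp add: dist_norm norm_minus_commute)
    then show False using far[OF e(2)] e(1) \<open>dist x w > 0\<close> by simp
  qed
  then show ?thesis using point_label_mono[OF w] w by blast
qed

section \<open>The mixed-integer problem\<close>

lemma polyhedron_feasible_polyhedron: "polyhedron (feasible_polyhedron A B b)"
proof -
  have "feasible_polyhedron A B b = \<Inter> (range (\<lambda>i. {p. (A $ i, B $ i) \<bullet> p \<le> b $ i}))"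
    by (auto simp: feasible_polyhedron_def matrix_vector_mul_component)
  also have "polyhedron \<dots>"
    by (rule polyhedron_Inter) (auto intro: polyhedron_halfspace_le)
  finally show ?thesis .
qed

lemma describes_facesD:
  assumes "describes_faces A B b R" "F \<in> low_dim_faces (feasible_polyhedron A B b)"
  shows "(x, y) \<in> F \<longleftrightarrow>
    (x, y) \<in> feasible_polyhedron A B b \<and> (\<forall>i \<in> R F. (A *v x + B *v y) $ i = b $ i)"
  using assms unfolding describes_faces_def by blast

text \<open>
  A solution with \<open>s = 1\<close> exists over every \<open>x \<in> X\<close>: take all \<open>z\<^sub>F = 0\<close>, so that the rows of each
  face are relaxed to the bound given by \<open>M\<close>.
\<close>

lemma mip_feasible_zero:
  assumes M: "\<forall>(x, y) \<in> feasible_polyhedron A B b. \<forall>i. (A *v x + B *v y) $ i - b $ i \<ge> - (M $ i)"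
    and p: "(x, y) \<in> feasible_polyhedron A B b"
  shows "mip_feasible A B b M R V (\<lambda>F. 0) 1 x (\<lambda>F. y)"
proof -
  have "b $ i - M $ i \<le> (A *v x + B *v y) $ i" for i
    using bspec[OF M p] by (auto dest: spec[of _ i])
  moreover have "(A *v x + B *v y) $ i \<le> b $ i" for i
    using p by (auto simp: feasible_polyhedron_def)
  ultimately show ?thesis by (auto simp: mip_feasible_def Let_def)
qed

lemma mip_feasible_label:
  fixes A :: "real ^ 'nx ^ 'm" and B :: "real ^ 'ny ^ 'm"
  assumes D_def: "D = feasible_polyhedron A B b"
    and fin: "finite (low_dim_faces D)"
    and R: "describes_faces A B b R"
    and M: "\<forall>(x, y) \<in> D. \<forall>i. (A *v x + B *v y) $ i - b $ i \<ge> - (M $ i)"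
    and x: "x \<in> fst ` D"
    and V: "\<And>v. v \<in> V \<Longrightarrow> \<not> point_label D x \<subseteq> point_label D v"
  shows "\<exists>y. mip_feasible A B b M R V (\<lambda>F. of_bool (F \<in> point_label D x)) 0 x y"
proof -
  let ?z = "\<lambda>F. of_bool (F \<in> point_label D x) :: real"
  have "\<exists>y. (x, y) \<in> D \<and> (F \<in> point_label D x \<longrightarrow> (x, y) \<in> F)" if F: "F \<in> low_dim_faces D" for F
  proof (cases "F \<in> point_label D x")
    case True
    then obtain y where "(x, y) \<in> F" by (auto simp: point_label_eq)
    moreover have "F \<subseteq> D" using F by (auto simp: low_dim_faces_def polytope_faces_def)
    ultimately show ?thesis by blast
  next
    case False
    then show ?thesis using x by auto
  qed
  then obtain y where y: "\<And>F. F \<in> low_dim_faces D \<Longrightarrow> (x, y F) \<in> D"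
    and yF: "\<And>F. F \<in> low_dim_faces D \<Longrightarrow> F \<in> point_label D x \<Longrightarrow> (x, y F) \<in> F"
    by metis
  have "(A *v x + B *v y F) $ i \<le> b $ i" if "F \<in> low_dim_faces D" for F i
    using y[OF that] by (auto simp: D_def feasible_polyhedron_def)
  moreover have "(A *v x + B *v y F) $ i \<ge> b $ i - M $ i * (1 - ?z F)"
    if F: "F \<in> low_dim_faces D" and i: "i \<in> R F" for F i
  proof (cases "F \<in> point_label D x")
    case True
    then show ?thesis
      using describes_facesD[OF R F[unfolded D_def]] yF[OF F True] i by simp
  next
    case False
    then show ?thesis using bspec[OF M y[OF F]] by (auto dest: spec[of _ i])
  qed
  moreover have "1 \<le> (\<Sum>F \<in> low_dim_faces D - point_label D v. ?z F)" if v: "v \<in> V" for v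
  proof -
    obtain F where F: "F \<in> point_label D x" "F \<notin> point_label D v" using V[OF v] by blast
    then have "?z F \<le> (\<Sum>F \<in> low_dim_faces D - point_label D v. ?z F)"
      using fin by (intro member_le_sum) (auto simp: point_label_eq)
    then show ?thesis using F by simp
  qed
  moreover have "(\<Sum>F \<in> low_dim_faces D. ?z F) \<le> real (card (low_dim_faces D))"
    using sum_bounded_above[of "low_dim_faces D" ?z 1] by simp
  ultimately show ?thesis
    unfolding mip_feasible_def Let_def D_def[symmetric] by (intro exI[of _ y]) auto
qed

lemma mip_objective_label:
  assumes "finite (low_dim_faces D)"
  shows "mip_objective D (\<lambda>F. of_bool (F \<in> point_label D x)) = card (point_label D x)"
proof -
  have "low_dim_faces D \<inter> {F. F \<in> point_label D x} = point_label D x"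
    by (auto simp: point_label_eq)
  then show ?thesis using assms by (simp add: mip_objective_def sum_of_bool_eq)
qed

text \<open>The support of \<open>z\<close> in a feasible solution lies in the label of \<open>x\<close>.\<close>

lemma mip_feasible_support:
  fixes A :: "real ^ 'nx ^ 'm" and B :: "real ^ 'ny ^ 'm"
  assumes D_def: "D = feasible_polyhedron A B b"
    and R: "describes_faces A B b R"
    and feas: "mip_feasible A B b M R V z s x y"
    and F: "F \<in> low_dim_faces D" and z: "z F \<noteq> 0"
  shows "F \<in> point_label D x" and "z F = 1"
proof -
  show z1: "z F = 1"
    using feas F z by (auto simp: mip_feasible_def Let_def D_def)
  have le: "(A *v x + B *v y F) $ i \<le> b $ i" for i
    using feas F by (auto simp: mip_feasible_def Let_def D_def)
  have ge: "b $ i \<le> (A *v x + B *v y F) $ i" if "i \<in> R F" for i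
  proof -
    have "b $ i - M $ i * (1 - z F) \<le> (A *v x + B *v y F) $ i"
      using feas F that unfolding mip_feasible_def Let_def D_def[symmetric] by blast
    then show ?thesis using z1 by simp
  qed
  have "(x, y F) \<in> F"
    unfolding describes_facesD[OF R F[unfolded D_def]]
    using le ge by (auto simp: feasible_polyhedron_def intro: antisym)
  then show "F \<in> point_label D x" using F by (force simp: point_label_eq)
qed

lemma mip_objective_le_card_label:
  assumes D_def: "D = feasible_polyhedron A B b"
    and fin: "finite (low_dim_faces D)"
    and R: "describes_faces A B b R"
    and feas: "mip_feasible A B b M R V z s x y"
  shows "mip_objective D z \<le> card (point_label D x)"
proof -
  note supp = mip_feasible_support[OF D_def R feas]
  have "mip_objective D z \<le> (\<Sum>F \<in> low_dim_faces D. of_bool (F \<in> point_label D x))"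
    unfolding mip_objective_def by (rule sum_mono) (use supp in force)
  then show ?thesis
    using mip_objective_label[OF fin, of x] by (simp add: mip_objective_def)
qed

theorem lemma5p4:
  fixes A :: "real ^ 'nx ^ 'm" and B :: "real ^ 'ny ^ 'm" and b M :: "real ^ 'm"
    and D :: "((real ^ 'nx) \<times> (real ^ 'ny)) set"
    and R :: "((real ^ 'nx) \<times> (real ^ 'ny)) set \<Rightarrow> 'm set"
    and V :: "(real ^ 'nx) set"
  assumes D_def: "D = feasible_polyhedron A B b"
    and compact: "compact D"
    and full_dim: "aff_dim D = int DIM((real ^ 'nx) \<times> (real ^ 'ny))"
    and rows: "describes_faces A B b R"
    and M_pos: "\<forall>i. M $ i > 0"
    and M_bound: "\<forall>(x, y) \<in> D. \<forall>i. (A *v x + B *v y) $ i - b $ i \<ge> - (M $ i)"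
    and V_sub: "V \<subseteq> chamber_vertices D"
  shows "(D \<noteq> {} \<longrightarrow> (\<exists>z s x y. mip_feasible A B b M R V z s x y)) \<and>
    (\<forall>z s x y. mip_optimal A B b M R V z s x y \<longrightarrow>
      (let P = (s = 0 \<and> x \<in> chamber_vertices D - V);
           Q = (s = 1 \<and> chamber_vertices D = V)
       in (P \<or> Q) \<and> \<not> (P \<and> Q)))"
proof (intro conjI impI allI)
  have D: "polytope D"
    using compact polyhedron_feasible_polyhedron[of A B b]
    by (simp add: polytope_eq_bounded_polyhedron compact_imp_bounded D_def)
  have Dne: "D \<noteq> {}" using full_dim by auto
  note fin = finite_low_dim_faces[OF D Dne]
  {
    obtain x y where "(x, y) \<in> D" using Dne by auto
    then show "\<exists>z s x y. mip_feasible A B b M R V z s x y"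
      using mip_feasible_zero[OF M_bound[unfolded D_def]] unfolding D_def by blast
  }
  fix z s x y assume opt: "mip_optimal A B b M R V z s x y"
  then have feas: "mip_feasible A B b M R V z s x y"
    and best: "\<And>z' s' x' y'. mip_feasible A B b M R V z' s' x' y' \<Longrightarrow>
      mip_objective D z' \<le> mip_objective D z"
    unfolding mip_optimal_def D_def by blast+
  note supp = mip_feasible_support[OF D_def rows feas]
  have s01: "s = 0 \<or> s = 1"
    using feas by (auto simp: mip_feasible_def Let_def)
  have zero: "x \<in> chamber_vertices D - V" if s: "s = 0"
  proof -
    have not_sub: "\<exists>F \<in> low_dim_faces D. F \<in> point_label D x \<and> F \<notin> point_label D v" if v: "v \<in> V" for v
    proof -
      have "1 \<le> (\<Sum>F \<in> low_dim_faces D - point_label D v. z F)"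
        using feas v s by (auto simp: mip_feasible_def Let_def D_def)
      then have "\<exists>F \<in> low_dim_faces D - point_label D v. z F \<noteq> 0"
        by (metis not_one_le_zero sum.neutral)
      then show ?thesis using supp by blast
    qed
    then have "x \<notin> V" by blast
    \<comment> \<open>The low-dimensional faces are not the empty family, so the constraints do force \<open>x \<in> X\<close>.\<close>
    obtain F where "F \<in> low_dim_faces D"
      using low_dim_subface[OF D Dne face_of_refl[OF polytope_imp_convex[OF D]]] Dne by blast
    then have "(x, y F) \<in> D"
      using feas by (auto simp: mip_feasible_def Let_def D_def feasible_polyhedron_def)
    then have xX: "x \<in> fst ` D" by force
    have "chamber D x = {x}"
    proof (rule ccontr)
      assume "chamber D x \<noteq> {x}"
      then obtain w where w: "w \<in> chamber D x" "point_label D x \<subset> point_label D w"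
        using label_grows_in_nontrivial_chamber[OF D Dne xX] by blast
      have "D \<in> polytope_faces D"
        using face_of_refl[OF polytope_imp_convex[OF D]] Dne by (simp add: polytope_faces_eq[OF D Dne])
      then have wX: "w \<in> fst ` D" using mem_chamberD[OF w(1)] xX by blast
      have "\<not> point_label D w \<subseteq> point_label D v" if "v \<in> V" for v
        using not_sub[OF that] w(2) by blast
      then obtain y' where
        "mip_feasible A B b M R V (\<lambda>F. of_bool (F \<in> point_label D w)) 0 w y'"
        using mip_feasible_label[OF D_def fin rows M_bound wX] by blast
      from best[OF this] have "card (point_label D w) \<le> card (point_label D x)"
        using mip_objective_label[OF fin, of w] mip_objective_le_card_label[OF D_def fin rows feas]
        by linarith
      moreover have "card (point_label D x) < card (point_label D w)"
        using w(2) fin by (intro psubset_card_mono) (auto simp: point_label_eq)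
      ultimately show False by simp
    qed
    then show ?thesis using xX \<open>x \<notin> V\<close> by (simp add: chamber_vertices_eq)
  qed
  have one: "chamber_vertices D = V" if s: "s = 1"
  proof (rule ccontr)
    assume "chamber_vertices D \<noteq> V"
    then obtain v where v: "v \<in> chamber_vertices D" "v \<notin> V" using V_sub by blast
    then have vX: "v \<in> fst ` D" by (simp add: chamber_vertices_eq)
    have "\<not> point_label D v \<subseteq> point_label D w" if "w \<in> V" for w
      using chamber_vertex_label_maximal[OF D Dne v(1), of w] v(2) that by blast
    then obtain y' where
      "mip_feasible A B b M R V (\<lambda>F. of_bool (F \<in> point_label D v)) 0 v y'"
      using mip_feasible_label[OF D_def fin rows M_bound vX] by blast
    from best[OF this] have "real (card (point_label D v)) \<le> mip_objective D z"
      by (simp add: mip_objective_label[OF fin])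
    also have "\<dots> \<le> 0"
      using feas s by (auto simp: mip_feasible_def Let_def mip_objective_def D_def)
    finally have "card (point_label D v) = 0" by simp
    moreover have "finite (point_label D v)" using fin by (simp add: point_label_eq)
    ultimately show False using point_label_nonempty[OF D Dne vX] by simp
  qed
  show "let P = (s = 0 \<and> x \<in> chamber_vertices D - V);
            Q = (s = 1 \<and> chamber_vertices D = V)
        in (P \<or> Q) \<and> \<not> (P \<and> Q)"
    unfolding Let_def using s01 zero one by auto
qed

end
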